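(* Let $\mathbb{F}$ be a field, let $\Gamma$ be an additive subgroup of $\mathbb{F}^t$, let $b:\mathbb{F}^d\times\mathbb{F}^t\to\mathbb{F}^k$ be a bilinear map, and let $(G=(V,E),\psi)$ be a finite $\Gamma$-gain graph. Define $\mu_b(X)=\dim_{\mathbb{F}}\operatorname{span}\{b(\alpha,\gamma)\mid\alpha\in\mathbb{F}^d,\gamma\in X\}$ for $X\subseteq\Gamma$ and $f_b(F)=d|V(F)|-d\,c(F)+\mu_b(\langle\langle F\rangle\rangle)$ for $F\subseteq E$. Then $$f_b(E)=\dim_{\mathbb{F}}\operatorname{span}\{L_{e,\psi}\mid e\in E\}.$$
   Context: A $\Gamma$-gain graph: $G$ finite directed graph (loops, parallel edges allowed), $\psi:E\to\Gamma$, reversing an edge negates its gain; the gain of a walk is the sum of its edge gains, with $-\psi(e)$ for edges traversed backwards. $V(F)$ = endvertices of $F$; $c(F)$ = number of connected components of $(V(F),F)$; $\langle\langle F\rangle\rangle$ = subgroup generated by the gains of all closed walks using only edges of $F$. Work in $(\mathbb{F}^d)^V\oplus\mathbb{F}^k$, writing $x(\ast)$ for the $\mathbb{F}^k$-component and $x(W)=0$ for $x(w)=0$ for all $w\in W$. For a non-loop edge $e$ from $i$ to $j$: $L_{e,\psi}=\{x: x(i)+x(j)=0,\ b(x(i),\psi(e))+x(\ast)=0,\ x(V\setminus\{i,j\})=0\}$. For a loop $e$: $L_{e,\psi}=\{x:\exists\alpha\in\mathbb{F}^d,\ x(\ast)=-b(\alpha,\psi(e)),\ x(V)=0\}$. 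*)

theory Defs
  imports
    "HOL-Analysis.Analysis"
    "HOL-Library.Function_Algebras"
    "HOL-Computational_Algebra.Group_Closure"
    "Graph_Theory.Digraph_Component"
begin

definition bilinear_over :: "('f::field ^ 'd \<Rightarrow> 'f ^ 't \<Rightarrow> 'f ^ 'k) \<Rightarrow> bool" where
  "bilinear_over b \<longleftrightarrow>
     (\<forall>\<alpha>. Vector_Spaces.linear (*s) (*s) (\<lambda>\<gamma>. b \<alpha> \<gamma>)) \<and>
     (\<forall>\<gamma>. Vector_Spaces.linear (*s) (*s) (\<lambda>\<alpha>. b \<alpha> \<gamma>))"

text \<open>Loops and parallel arcs are permitted by \<^locale>\<open>fin_digraph\<close>.\<close>

locale gain_graph = fin_digraph G
  for G :: "('v, 'e) pre_digraph" +
  fixes \<Gamma> :: "'a::ab_group_add set" and \<psi> :: "'e \<Rightarrow> 'a"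
  assumes zero_in_gains: "0 \<in> \<Gamma>"
    and add_in_gains: "x \<in> \<Gamma> \<Longrightarrow> y \<in> \<Gamma> \<Longrightarrow> x + y \<in> \<Gamma>"
    and minus_in_gains: "x \<in> \<Gamma> \<Longrightarrow> - x \<in> \<Gamma>"
    and gain_in_gains: "e \<in> arcs G \<Longrightarrow> \<psi> e \<in> \<Gamma>"

definition edge_subgraph :: "('v, 'e) pre_digraph \<Rightarrow> 'e set \<Rightarrow> ('v, 'e) pre_digraph" where
  "edge_subgraph G F =
     \<lparr>verts = tail G ` F \<union> head G ` F, arcs = F, tail = tail G, head = head G\<rparr>"

text \<open>
  Walks may traverse edges backwards, so they are directed walks in the digraph in which
  every arc \<open>e\<close> is replaced by \<open>(e, True)\<close> (same direction) and \<open>(e, False)\<close> (reversed).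
\<close>

definition two_way :: "('v, 'e) pre_digraph \<Rightarrow> ('v, 'e \<times> bool) pre_digraph" where
  "two_way G =
     \<lparr>verts = verts G, arcs = arcs G \<times> UNIV,
      tail = (\<lambda>(e, forward). if forward then tail G e else head G e),
      head = (\<lambda>(e, forward). if forward then head G e else tail G e)\<rparr>"

definition walk_gain :: "('e \<Rightarrow> 'a::ab_group_add) \<Rightarrow> ('e \<times> bool) list \<Rightarrow> 'a" where
  "walk_gain \<psi> p = (\<Sum>(e, forward) \<leftarrow> p. if forward then \<psi> e else - \<psi> e)"

definition gain_subgroup ::
    "('v, 'e) pre_digraph \<Rightarrow> ('e \<Rightarrow> 'a::ab_group_add) \<Rightarrow> 'e set \<Rightarrow> 'a set" where
  "gain_subgroup G \<psi> F =
     group_closure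
       {walk_gain \<psi> p | v p. pre_digraph.awalk (two_way (edge_subgraph G F)) v p v}"

text \<open>
  The strong components of the symmetric closure are the connected components of the
  underlying undirected graph.
\<close>

definition num_components :: "('v, 'e) pre_digraph \<Rightarrow> 'e set \<Rightarrow> nat" where
  "num_components G F =
     card (pre_digraph.sccs_verts (with_proj (mk_symmetric (edge_subgraph G F))))"

definition gain_dim :: "('f::field ^ 'd \<Rightarrow> 'f ^ 't \<Rightarrow> 'f ^ 'k) \<Rightarrow> ('f ^ 't) set \<Rightarrow> nat" where
  "gain_dim b X = vec.dim (vec.span {b \<alpha> \<gamma> | \<alpha> \<gamma>. \<gamma> \<in> X})"

text \<open>Integer-valued, to avoid the truncated subtraction of natural numbers.\<close>

definition gain_rank ::
    "('f::field ^ 'd \<Rightarrow> 'f ^ 't \<Rightarrow> 'f ^ 'k) \<Rightarrow> ('v, 'e) pre_digraph \<Rightarrow>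
     ('e \<Rightarrow> 'f ^ 't) \<Rightarrow> 'e set \<Rightarrow> int" where
  "gain_rank b G \<psi> F =
     int CARD('d) * int (card (verts (edge_subgraph G F)))
     - int CARD('d) * int (num_components G F)
     + int (gain_dim b (gain_subgroup G \<psi> F))"

text \<open>
  The ambient space is the direct sum of \<open>(\<bbbF>\<^sup>d)\<^sup>V\<close> and \<open>\<bbbF>\<^sup>k\<close>. Its elements are pairs \<open>(x, z)\<close>,
  where \<open>x\<close> vanishes outside \<open>V\<close> and \<open>z\<close> is the component \<open>x(\<ast>)\<close>. The vector space structure
  is defined on all pairs; addition is componentwise.
\<close>

definition gain_scale ::
    "'f::field \<Rightarrow> ('v \<Rightarrow> 'f ^ 'd) \<times> ('f ^ 'k) \<Rightarrow> ('v \<Rightarrow> 'f ^ 'd) \<times> ('f ^ 'k)" where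
  "gain_scale c = (\<lambda>(x, z). (\<lambda>v. c *s x v, c *s z))"

global_interpretation gain_space: vector_space
  "gain_scale :: 'f::field \<Rightarrow> ('v \<Rightarrow> 'f ^ 'd) \<times> ('f ^ 'k) \<Rightarrow> ('v \<Rightarrow> 'f ^ 'd) \<times> ('f ^ 'k)"
  by unfold_locales
    (auto simp: gain_scale_def fun_eq_iff vec_eq_iff algebra_simps)

definition ambient_space ::
    "('v, 'e) pre_digraph \<Rightarrow> (('v \<Rightarrow> 'f::field ^ 'd) \<times> ('f ^ 'k)) set" where
  "ambient_space G = {(x, z). \<forall>v. v \<notin> verts G \<longrightarrow> x v = 0}"

definition edge_space ::
    "('f::field ^ 'd \<Rightarrow> 'f ^ 't \<Rightarrow> 'f ^ 'k) \<Rightarrow> ('v, 'e) pre_digraph \<Rightarrow>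
     ('e \<Rightarrow> 'f ^ 't) \<Rightarrow> 'e \<Rightarrow> (('v \<Rightarrow> 'f ^ 'd) \<times> ('f ^ 'k)) set" where
  "edge_space b G \<psi> e =
     (let i = tail G e; j = head G e in
      if i \<noteq> j then
        {(x, z) \<in> ambient_space G.
           x i + x j = 0 \<and> b (x i) (\<psi> e) + z = 0 \<and> (\<forall>v \<in> verts G - {i, j}. x v = 0)}
      else
        {(x, z) \<in> ambient_space G.
           \<exists>\<alpha>. z = - b \<alpha> (\<psi> e) \<and> (\<forall>v \<in> verts G. x v = 0)})"

end

theory Submission
  imports Defs
begin

text \<open>
  Every edge from \<open>i\<close> to \<open>j\<close>, loop or not, contributes the vectors \<open>\<alpha>\<close> at \<open>i\<close>, \<open>-\<alpha>\<close> at \<open>j\<close>,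
  \<open>-b(\<alpha>, \<psi>(e))\<close> at \<open>\<ast>\<close>. Along a walk these telescope, so a closed walk of gain \<open>\<gamma>\<close> yields
  the central vector \<open>b(\<alpha>, \<gamma>)\<close> at \<open>\<ast>\<close>. Fix a root in each component and a walk from each
  vertex to its root. Modulo the central vectors, the edge vectors are differences of the vectors
  of these walks, and the latter are independent for the non-root vertices: there are
  \<open>d (|V| - c)\<close> of them, and the central vectors span a space of dimension \<open>\<mu>\<^sub>b\<close>.
\<close>

section \<open>Edge spaces as ranges of linear maps\<close>

definition link ::
    "('f::field ^ 'd \<Rightarrow> 'f ^ 't \<Rightarrow> 'f ^ 'k) \<Rightarrow> 'v \<Rightarrow> 'v \<Rightarrow> 'f ^ 't \<Rightarrow> 'f ^ 'd \<Rightarrow>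
     ('v \<Rightarrow> 'f ^ 'd) \<times> ('f ^ 'k)" where
  "link b u v \<gamma> \<alpha> = ((\<lambda>w. (if w = u then \<alpha> else 0) - (if w = v then \<alpha> else 0)), - b \<alpha> \<gamma>)"

text \<open>For a non-loop, the value at the tail is a free parameter that fixes the value at the
  head and at \<open>*\<close>. For a loop, the parameter is the existentially quantified
  \<open>\<alpha>\<close>.\<close>

lemma (in wf_digraph) edge_space_eq_range_link:
  assumes b: "\<And>\<gamma>. b 0 \<gamma> = 0" and e: "e \<in> arcs G"
  shows "edge_space b G \<psi> e = range (link b (tail G e) (head G e) (\<psi> e))"
proof -
  let ?i = "tail G e" and ?j = "head G e"
  have ends: "?i \<in> verts G" "?j \<in> verts G"
    using e by auto
  show ?thesis
  proof (cases "?i = ?j")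
    case True
    then show ?thesis
      by (auto simp: edge_space_def link_def ambient_space_def fun_eq_iff)
  next
    case False
    have "y \<in> range (link b ?i ?j (\<psi> e))" if "y \<in> edge_space b G \<psi> e" for y
    proof -
      obtain x z where [simp]: "y = (x, z)"
        by (cases y)
      have *: "x v = 0" if "v \<notin> verts G" for v
        using \<open>y \<in> _\<close> False that by (auto simp: edge_space_def ambient_space_def Let_def)
      have **: "x ?i + x ?j = 0" "b (x ?i) (\<psi> e) + z = 0" "\<forall>v \<in> verts G - {?i, ?j}. x v = 0"
        using \<open>y \<in> _\<close> False by (auto simp: edge_space_def Let_def)
      have "y = link b ?i ?j (\<psi> e) (x ?i)"
        using * **(3) False add.inverse_unique[OF **(1)] add.inverse_unique[OF **(2)]
        by (auto simp: link_def fun_eq_iff)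
      then show ?thesis
        by blast
    qed
    moreover have "link b ?i ?j (\<psi> e) \<alpha> \<in> edge_space b G \<psi> e" for \<alpha>
      using False ends by (auto simp: edge_space_def link_def ambient_space_def Let_def)
    ultimately show ?thesis
      by blast
  qed
qed

section \<open>Walks in both directions and their gains\<close>

lemma verts_two_way [simp]: "verts (two_way H) = verts H"
  and arcs_two_way [simp]: "arcs (two_way H) = arcs H \<times> UNIV"
  and tail_two_way [simp]: "tail (two_way H) (e, d) = (if d then tail H e else head H e)"
  and head_two_way [simp]: "head (two_way H) (e, d) = (if d then head H e else tail H e)"
  by (auto simp: two_way_def)

text \<open>Reachability depends only on the pairs of ends of arcs. Hence the components counted
  through \<open>mk_symmetric\<close> are those of the digraph whose walks carry the gains.\<close>

lemma arcs_ends_two_way: "arcs_ends (two_way H) = parcs (mk_symmetric H)"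
proof -
  have "(\<exists>x \<in> arcs H \<times> UNIV. p = arc_to_ends (two_way H) x) \<longleftrightarrow>
      (\<exists>e \<in> arcs H. \<exists>d. p = arc_to_ends (two_way H) (e, d))" for p
    by auto
  then show ?thesis
    by (auto simp: arcs_ends_def arc_to_ends_def parcs_mk_symmetric ex_bool_eq set_eq_iff image_iff)
qed

lemma (in wf_digraph) sym_digraph_two_way: "sym_digraph (two_way G)"
proof
  show "symmetric (two_way G)"
    by (auto simp: symmetric_def arcs_ends_two_way parcs_mk_symmetric intro: symI)
qed (auto simp: two_way_def)

lemma sccs_verts_two_way:
  "pre_digraph.sccs_verts (two_way H) = pre_digraph.sccs_verts (with_proj (mk_symmetric H))"
  by (simp add: pre_digraph.sccs_verts_def reachable_def arcs_ends_two_way)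

lemma walk_gain_Nil [simp]: "walk_gain \<psi> [] = 0"
  and walk_gain_Cons [simp]:
    "walk_gain \<psi> ((e, d) # p) = (if d then \<psi> e else - \<psi> e) + walk_gain \<psi> p"
  and walk_gain_append [simp]: "walk_gain \<psi> (p @ q) = walk_gain \<psi> p + walk_gain \<psi> q"
  by (simp_all add: walk_gain_def)

section \<open>Representatives of components\<close>

context sym_digraph
begin

lemma scc_of_eqI: "u \<in> scc_of v \<Longrightarrow> scc_of u = scc_of v"
  by (auto simp: scc_of_def intro: reachable_trans)

text \<open>The choice depends only on the set \<open>scc_of v\<close>, so vertices with the same
  component get the same root.\<close>

definition component_root :: "'a \<Rightarrow> 'a" where
  "component_root v = (SOME u. u \<in> scc_of v)"

lemma component_root_in_scc_of: "v \<in> verts G \<Longrightarrow> component_root v \<in> scc_of v"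
  unfolding component_root_def by (rule someI) (rule in_scc_of_self)

lemma component_root_in_verts: "v \<in> verts G \<Longrightarrow> component_root v \<in> verts G"
  using component_root_in_scc_of[of v] by (auto simp: scc_of_def dest: reachable_in_verts)

lemma component_root_idem:
  "v \<in> verts G \<Longrightarrow> component_root (component_root v) = component_root v"
  using scc_of_eqI[OF component_root_in_scc_of, of v] by (simp add: component_root_def)

lemma component_root_cong: "u \<rightarrow>\<^sup>* v \<Longrightarrow> component_root u = component_root v"
  using scc_of_eqI[OF scc_ofI_reachable, of u v] by (simp add: component_root_def)

text \<open>\<open>scc_of\<close> maps the roots bijectively onto the components, since a vertex and
  its root have the same component.\<close>

lemma card_component_roots: "card (component_root ` verts G) = card sccs_verts"
proof -
  have scc: "scc_of (component_root v) = scc_of v" if "v \<in> verts G" for v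
    using that by (intro scc_of_eqI component_root_in_scc_of)
  then have "inj_on scc_of (component_root ` verts G)"
    by (auto simp: inj_on_def component_root_def)
  moreover have "scc_of ` component_root ` verts G = sccs_verts"
    using scc by (auto simp: sccs_verts_conv_scc_of image_image)
  ultimately show ?thesis
    by (metis card_image)
qed

end

section \<open>Central vectors and the calculus of links\<close>

lemma linear_Pair_zero: "Vector_Spaces.linear (*s) gain_scale (Pair 0)"
  by unfold_locales (auto simp: gain_scale_def fun_eq_iff vec_eq_iff algebra_simps)

lemma span_Pair_zero_image: "gain_space.span (Pair 0 ` A) = Pair 0 ` vec.span A"
proof -
  interpret Vector_Spaces.linear "(*s)" gain_scale "Pair 0"
    by (rule linear_Pair_zero)
  show ?thesis
    by (rule span_image)
qed

locale bilinear_gain_graph = gain_graph G \<Gamma> \<psi>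
  for G :: "('v, 'e) pre_digraph" and \<Gamma> :: "('f::field ^ 't) set" and \<psi> :: "'e \<Rightarrow> 'f ^ 't" +
  fixes b :: "'f ^ 'd \<Rightarrow> 'f ^ 't \<Rightarrow> 'f ^ 'k"
  assumes bilinear: "bilinear_over b"
begin

sublocale left: Vector_Spaces.linear "(*s)" "(*s)" "\<lambda>\<alpha>. b \<alpha> \<gamma>" for \<gamma>
  using bilinear by (simp add: bilinear_over_def)

sublocale right: Vector_Spaces.linear "(*s)" "(*s)" "b \<alpha>" for \<alpha>
  using bilinear by (simp add: bilinear_over_def)

lemma linear_link: "Vector_Spaces.linear (*s) gain_scale (link b u v \<gamma>)"
  by unfold_locales
    (auto simp: link_def gain_scale_def fun_eq_iff vec_eq_iff left.add left.scale algebra_simps)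

lemma link_add: "link b u v \<gamma> \<alpha> + link b v w \<gamma>' \<alpha> = link b u w (\<gamma> + \<gamma>') \<alpha>"
  by (auto simp: link_def fun_eq_iff right.add)

text \<open>Traversing an edge backwards thus only negates the parameter and stays in the same edge
  space.\<close>

lemma link_minus: "link b v u (- \<gamma>) \<alpha> = link b u v \<gamma> (- \<alpha>)"
  by (auto simp: link_def fun_eq_iff right.neg left.neg)

text \<open>The two indicators cancel when the ends agree, so loops and closed walks give purely
  central vectors.\<close>

lemma link_loop: "link b v v \<gamma> \<alpha> = (0, - b \<alpha> \<gamma>)"
  by (auto simp: link_def fun_eq_iff)

text \<open>\<open>G\<close> may have isolated vertices; the rank formula counts only endvertices of
  edges.\<close>

definition support_graph :: "('v, 'e) pre_digraph" where
  "support_graph = edge_subgraph G (arcs G)"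

lemma support_graph_simps [simp]:
  "arcs support_graph = arcs G" "tail support_graph = tail G" "head support_graph = head G"
  "verts support_graph = tail G ` arcs G \<union> head G ` arcs G"
  by (simp_all add: support_graph_def edge_subgraph_def)

sublocale walks: sym_digraph "two_way support_graph"
proof (rule wf_digraph.sym_digraph_two_way)
  show "wf_digraph support_graph"
    by standard auto
qed

lemma finite_support: "finite (verts support_graph)"
  by simp

abbreviation gains :: "('f ^ 't) set" where
  "gains \<equiv> gain_subgroup G \<psi> (arcs G)"

lemma gains_eq: "gains = group_closure {walk_gain \<psi> p | v p. walks.awalk v p v}"
  by (simp add: gain_subgroup_def support_graph_def)

lemma walk_gain_in_gains: "walks.awalk v p v \<Longrightarrow> walk_gain \<psi> p \<in> gains"
  unfolding gains_eq by (intro group_closure.base) blast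

section \<open>Walk vectors and central vectors in the edge span\<close>

abbreviation gain_values :: "('f ^ 'k) set" where
  "gain_values \<equiv> vec.span {b \<alpha> \<gamma> | \<alpha> \<gamma>. \<gamma> \<in> gains}"

abbreviation edge_span :: "(('v \<Rightarrow> 'f ^ 'd) \<times> ('f ^ 'k)) set" where
  "edge_span \<equiv> gain_space.span (\<Union>e \<in> arcs G. edge_space b G \<psi> e)"

lemma edge_span_eq:
  "edge_span = gain_space.span (\<Union>e \<in> arcs G. range (link b (tail G e) (head G e) (\<psi> e)))"
  by (simp add: edge_space_eq_range_link left.zero)

lemma link_arc_in_edge_span:
  "e \<in> arcs G \<Longrightarrow> link b (tail G e) (head G e) (\<psi> e) \<alpha> \<in> edge_span"
  unfolding edge_span_eq by (intro gain_space.span_base) blast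

text \<open>Peeling off the first step leaves a shorter walk, and \<open>link_add\<close> joins the
  two links.\<close>

lemma link_walk_in_edge_span:
  "walks.awalk u p v \<Longrightarrow> link b u v (walk_gain \<psi> p) \<alpha> \<in> edge_span"
proof (induction p arbitrary: u)
  case Nil
  then show ?case
    using gain_space.span_zero[of "\<Union>e \<in> arcs G. edge_space b G \<psi> e"]
    by (simp add: walks.awalk_Nil_iff link_loop right.zero zero_prod_def)
next
  case (Cons a p)
  obtain e d where [simp]: "a = (e, d)"
    by (cases a)
  define w where "w = (if d then head G e else tail G e)"
  have e: "e \<in> arcs G" and u: "u = (if d then tail G e else head G e)" and p: "walks.awalk w p v"
    using Cons.prems by (auto simp: walks.awalk_Cons_iff w_def)
  have "link b u w (if d then \<psi> e else - \<psi> e) \<alpha> \<in> edge_span"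
    using link_arc_in_edge_span[OF e] by (simp add: u w_def link_minus)
  from gain_space.span_add[OF this Cons.IH[OF p]] show ?case
    by (simp add: link_add)
qed

text \<open>For fixed \<open>\<alpha>\<close> the vector is additive in \<open>\<gamma>\<close>, so
  the generators suffice, and these are gains of closed walks.\<close>

lemma central_in_edge_span_gains: "\<gamma> \<in> gains \<Longrightarrow> (0, b \<alpha> \<gamma>) \<in> edge_span"
  unfolding gains_eq
proof (induction rule: group_closure.induct)
  case (base s)
  show ?case
  \<comment> \<open>The base rule of \<open>group_closure\<close> admits 0 besides the
    generators.\<close>
  proof (cases "s = 0")
    case True
    then show ?thesis
      using gain_space.span_zero[of "\<Union>e \<in> arcs G. edge_space b G \<psi> e"]
      by (simp add: right.zero zero_prod_def zero_fun_def)
  next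
    case False
    then obtain v p where "s = walk_gain \<psi> p" "walks.awalk v p v"
      using base by auto
    then show ?thesis
      \<comment> \<open>The parameter \<open>- \<alpha>\<close> compensates the minus sign in the
        central component of \<open>link\<close>.\<close>
      using link_walk_in_edge_span[of v p v "- \<alpha>"]
      by (simp add: link_loop left.neg zero_fun_def)
  qed
next
  case (diff s t)
  then show ?case
    using gain_space.span_diff[of "(0, b \<alpha> s)" _ "(0, b \<alpha> t)"]
    by (simp add: right.diff zero_fun_def)
qed

lemma central_in_edge_span:
  assumes "z \<in> gain_values"
  shows "(0, z) \<in> edge_span"
proof -
  have "gain_space.span (Pair 0 ` {b \<alpha> \<gamma> | \<alpha> \<gamma>. \<gamma> \<in> gains}) \<subseteq> edge_span"
    by (intro gain_space.span_minimal gain_space.subspace_span)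
      (auto intro: central_in_edge_span_gains)
  with assms show ?thesis
    by (auto simp: span_Pair_zero_image)
qed

section \<open>Potentials and spokes\<close>

abbreviation root :: "'v \<Rightarrow> 'v" where
  "root \<equiv> walks.component_root"

text \<open>At a root the chosen walk is closed but possibly nonempty, so the potential there is
  only known to lie in \<open>gains\<close>.\<close>

definition potential :: "'v \<Rightarrow> 'f ^ 't" where
  "potential v = walk_gain \<psi> (SOME p. walks.awalk v p (root v))"

lemma potential_walk:
  assumes "v \<in> verts support_graph"
  obtains p where "walks.awalk v p (root v)" "potential v = walk_gain \<psi> p"
proof -
  have "\<exists>p. walks.awalk v p (root v)"
    using walks.component_root_in_scc_of[of v] assms
    by (simp add: walks.scc_of_def walks.reachable_awalk)
  from someI_ex[OF this] show thesis
    by (rule that) (simp add: potential_def)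
qed

text \<open>The spokes replace each component by a star centred at its root.\<close>

definition spoke :: "'v \<Rightarrow> 'f ^ 'd \<Rightarrow> ('v \<Rightarrow> 'f ^ 'd) \<times> ('f ^ 'k)" where
  "spoke v = link b v (root v) (potential v)"

lemma spoke_in_edge_span: "v \<in> verts support_graph \<Longrightarrow> spoke v \<alpha> \<in> edge_span"
  by (metis potential_walk spoke_def link_walk_in_edge_span)

lemma potential_root_in_gains:
  assumes "v \<in> verts support_graph" "root v = v"
  shows "potential v \<in> gains"
  using assms by (metis potential_walk walk_gain_in_gains)

text \<open>This is the gain of the closed walk along \<open>e\<close>, on to the root by the walk
  chosen for the head, and back against the walk chosen for the tail.\<close>

lemma arc_gain_in_gains:
  assumes e: "e \<in> arcs G"
  shows "\<psi> e + potential (head G e) - potential (tail G e) \<in> gains"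
proof -
  let ?i = "tail G e" and ?j = "head G e"
  have ij: "?i \<in> verts support_graph" "?j \<in> verts support_graph"
    using e by auto
  have arc: "walks.awalk ?i [(e, True)] ?j"
    using e by (simp add: walks.awalk_Cons_iff walks.awalk_Nil_iff)
  then have root: "root ?j = root ?i"
    using walks.component_root_cong walks.reachable_awalk by metis
  obtain p where p: "walks.awalk ?i p (root ?i)" "potential ?i = walk_gain \<psi> p"
    using potential_walk[OF ij(1)] .
  obtain q where q: "walks.awalk ?j q (root ?i)" "potential ?j = walk_gain \<psi> q"
    using potential_walk[OF ij(2)] root by metis
  obtain r where r: "walks.awalk (root ?i) r ?i"
    using p(1) walks.symmetric_reachable'[of ?i "root ?i"] by (auto simp: walks.reachable_awalk)
  \<comment> \<open>Both closed walks return along the same \<open>r\<close>, which cancels in the difference.\<close>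
  have "walk_gain \<psi> (p @ r) \<in> gains"
    by (rule walk_gain_in_gains[OF walks.awalk_appendI[OF p(1) r]])
  moreover have "walk_gain \<psi> ([(e, True)] @ q @ r) \<in> gains"
    by (rule walk_gain_in_gains[OF walks.awalk_appendI[OF arc walks.awalk_appendI[OF q(1) r]]])
  ultimately have "walk_gain \<psi> ([(e, True)] @ q @ r) - walk_gain \<psi> (p @ r) \<in> gains"
    unfolding gains_eq by (rule group_closure.diff[rotated])
  then show ?thesis
    by (simp add: p q algebra_simps)
qed

text \<open>Both ends have the same root, so the root parts of the two spokes cancel; the last term
  corrects the central component.\<close>

lemma link_arc_eq:
  assumes "e \<in> arcs G"
  shows "link b (tail G e) (head G e) (\<psi> e) \<alpha> = spoke (tail G e) \<alpha> - spoke (head G e) \<alpha>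
    - (0, b \<alpha> (\<psi> e + potential (head G e) - potential (tail G e)))"
proof -
  have "walks.awalk (tail G e) [(e, True)] (head G e)"
    using assms by (simp add: walks.awalk_Cons_iff walks.awalk_Nil_iff)
  then have "root (head G e) = root (tail G e)"
    using walks.component_root_cong walks.reachable_awalk by metis
  then show ?thesis
    by (auto simp: spoke_def link_def fun_eq_iff right.add right.diff)
qed

section \<open>Independence of spokes and central vectors\<close>

abbreviation nonroots :: "'v set" where
  "nonroots \<equiv> verts support_graph - root ` verts support_graph"

lemma card_nonroots:
  "int (card nonroots) = int (card (verts support_graph)) - int (num_components G (arcs G))"
proof -
  have sub: "root ` verts support_graph \<subseteq> verts support_graph"
    using walks.component_root_in_verts by (auto simp del: support_graph_simps)
  have "card (root ` verts support_graph) = num_components G (arcs G)"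
    using walks.card_component_roots
    by (simp add: num_components_def sccs_verts_two_way flip: support_graph_def
        del: support_graph_simps)
  moreover have "card nonroots = card (verts support_graph) - card (root ` verts support_graph)"
    using finite_support sub by (intro card_Diff_subset) (auto intro: finite_subset)
  ultimately show ?thesis
    using card_mono[OF finite_support sub] by (simp add: of_nat_diff del: support_graph_simps)
qed

text \<open>The root end of a spoke lies outside \<open>nonroots\<close>, so on
  \<open>nonroots\<close> the spokes look like unit vectors.\<close>

lemma fst_spoke:
  assumes "u \<in> nonroots" "v \<in> nonroots"
  shows "fst (spoke u \<alpha>) v = (if v = u then \<alpha> else 0)"
  using assms by (auto simp: spoke_def link_def simp del: support_graph_simps)

text \<open>
  A linear map that kills the vectors of the chosen walks and fixes the central vectors, so that the
  two families are independent of each other.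
\<close>

definition central_part :: "('v \<Rightarrow> 'f ^ 'd) \<times> ('f ^ 'k) \<Rightarrow> 'f ^ 'k" where
  "central_part y = snd y + (\<Sum>v \<in> nonroots. b (fst y v) (potential v))"

lemma linear_central_part: "Vector_Spaces.linear gain_scale (*s) central_part"
proof unfold_locales
  fix y y' :: "('v \<Rightarrow> 'f ^ 'd) \<times> ('f ^ 'k)" and c :: 'f
  show "central_part (y + y') = central_part y + central_part y'"
    by (simp add: central_part_def left.add sum.distrib algebra_simps)
  show "central_part (gain_scale c y) = c *s central_part y"
    by (cases y)
      (simp add: central_part_def gain_scale_def left.scale vec.scale_right_distrib
        vec.scale_sum_right)
qed

text \<open>Only the summand at \<open>u\<close> survives, and it cancels the central component of
  the spoke.\<close>

lemma central_part_spoke: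
  assumes "u \<in> nonroots"
  shows "central_part (spoke u \<alpha>) = 0"
proof -
  have "(\<Sum>v \<in> nonroots. b (fst (spoke u \<alpha>) v) (potential v)) =
      (\<Sum>v \<in> nonroots. if v = u then b \<alpha> (potential v) else 0)"
    by (intro sum.cong refl) (simp add: fst_spoke[OF assms] left.zero del: support_graph_simps)
  also have "\<dots> = b \<alpha> (potential u)"
    using assms by (subst sum.delta) (auto simp del: Diff_iff)
  finally show ?thesis
    by (simp add: central_part_def spoke_def link_def)
qed

definition spokes :: "(('v \<Rightarrow> 'f ^ 'd) \<times> ('f ^ 'k)) set" where
  "spokes = (\<lambda>(v, i). spoke v (axis i 1)) ` (nonroots \<times> UNIV)"

lemma independent_spokes_Un_central:
  assumes B: "vec.independent B"
  shows "gain_space.independent (spokes \<union> Pair 0 ` B)"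
  unfolding gain_space.dependent_def
proof
  let ?W = "spokes \<union> Pair 0 ` B"
  assume "\<exists>a \<in> ?W. a \<in> gain_space.span (?W - {a})"
  then obtain a where a: "a \<in> ?W" "a \<in> gain_space.span (?W - {a})"
    by blast
  from a(1) show False
  proof
    assume "a \<in> spokes"
    then obtain v i where v: "v \<in> nonroots" and a_eq: "a = spoke v (axis i 1)"
      by (auto simp: spokes_def simp del: support_graph_simps)
    \<comment> \<open>The coordinate \<open>i\<close> at \<open>v\<close> is 1 on \<open>a\<close>
      and 0 on every other member of the family.\<close>
    have "gain_space.subspace {y :: ('v \<Rightarrow> 'f ^ 'd) \<times> ('f ^ 'k). fst y v $ i = 0}"
      by (auto simp: gain_space.subspace_def gain_scale_def)
    moreover have "?W - {a} \<subseteq> {y. fst y v $ i = 0}"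
      using v by (auto simp: spokes_def a_eq fst_spoke axis_def simp del: support_graph_simps)
    ultimately have "fst a v $ i = 0"
      using a(2) gain_space.span_minimal by blast
    then show False
      using v by (simp add: a_eq fst_spoke axis_def del: support_graph_simps)
  next
    assume "a \<in> Pair 0 ` B"
    then obtain m where m: "m \<in> B" and a_eq: "a = (0, m)"
      by auto
    interpret central_part: Vector_Spaces.linear gain_scale "(*s)" central_part
      by (rule linear_central_part)
    have central: "central_part (0, z) = z" for z
      by (simp add: central_part_def left.zero)
    \<comment> \<open>The preimage of the span of \<open>B - {m}\<close> contains all spokes, which
      go to 0, and all other central vectors, which are fixed; it misses \<open>a\<close> by
      independence of \<open>B\<close>.\<close>
    have "gain_space.subspace {y. central_part y \<in> vec.span (B - {m})}"
      by (rule central_part.subspace_vimage[unfolded vimage_def]) (rule vec.subspace_span)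
    moreover have "?W - {a} \<subseteq> {y. central_part y \<in> vec.span (B - {m})}"
      by (auto simp: spokes_def a_eq central_part_spoke vec.span_zero central
          simp del: support_graph_simps intro: vec.span_base)
    ultimately have "central_part a \<in> vec.span (B - {m})"
      using a(2) gain_space.span_minimal by blast
    then show False
      using B m by (auto simp: a_eq central vec.dependent_def)
  qed
qed

text \<open>The coordinate \<open>i\<close> at \<open>v\<close> distinguishes
  \<open>spoke v (axis i 1)\<close> from all other spokes and from every central vector.\<close>

lemma card_spokes_Un_central:
  assumes "finite B"
  shows "card (spokes \<union> Pair 0 ` B) = CARD('d) * card nonroots + card B"
proof -
  have "inj_on (\<lambda>(v, i). spoke v (axis i 1)) (nonroots \<times> UNIV)"
  proof (rule inj_onI, clarify del: DiffE)
    fix u v i j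
    assume uv: "u \<in> nonroots" "v \<in> nonroots" and eq: "spoke u (axis i 1) = spoke v (axis j 1)"
    have "fst (spoke u (axis i 1)) u $ i = fst (spoke v (axis j 1)) u $ i"
      by (simp only: eq)
    then show "u = v \<and> i = j"
      using uv by (simp add: fst_spoke axis_def split: if_splits del: support_graph_simps)
  qed
  then have "card spokes = card nonroots * CARD('d)"
    by (simp add: spokes_def card_image card_cartesian_product del: support_graph_simps)
  moreover have "spokes \<inter> Pair 0 ` B = {}"
  proof -
    have "(0, m) \<noteq> spoke v (axis i 1)" if "v \<in> nonroots" for v i m
    proof
      assume "(0, m) = spoke v (axis i 1)"
      then have "fst (spoke v (axis i 1)) v $ i = 0"
        by (simp flip: \<open>(0, m) = _\<close>)
      then show False
        using that by (simp add: fst_spoke axis_def del: support_graph_simps)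
    qed
    then show ?thesis
      by (auto simp: spokes_def simp del: support_graph_simps)
  qed
  moreover have "card (Pair (0 :: 'v \<Rightarrow> 'f ^ 'd) ` B) = card B"
    by (simp add: card_image inj_on_def)
  moreover have "finite spokes"
    by (simp add: spokes_def)
  ultimately show ?thesis
    using assms by (simp add: card_Un_disjoint mult.commute del: support_graph_simps)
qed

section \<open>A basis of the edge span and its dimension\<close>

lemma spokes_subset_edge_span: "spokes \<subseteq> edge_span"
  using spoke_in_edge_span by (auto simp: spokes_def simp del: support_graph_simps)

text \<open>By \<open>link_arc_eq\<close> each edge vector is a difference of spokes minus a central
  vector whose gain lies in \<open>gains\<close>, so it remains to generate spokes at all
  vertices.\<close>

lemma edge_span_subset:
  assumes B: "gain_values \<subseteq> vec.span B"
  shows "edge_span \<subseteq> gain_space.span (spokes \<union> Pair 0 ` B)" (is "_ \<subseteq> ?S")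
proof -
  have central: "(0, b \<alpha> \<gamma>) \<in> ?S" if "\<gamma> \<in> gains" for \<alpha> \<gamma>
  proof -
    have "b \<alpha> \<gamma> \<in> vec.span B"
      using B that by (blast intro: vec.span_base)
    then have "(0, b \<alpha> \<gamma>) \<in> gain_space.span (Pair 0 ` B)"
      by (auto simp: span_Pair_zero_image)
    then show ?thesis
      by (meson Un_upper2 gain_space.span_mono subsetD)
  qed
  have spoke: "spoke v \<alpha> \<in> ?S" if v: "v \<in> verts support_graph" for v \<alpha>
  \<comment> \<open>A spoke at a root is a loop and hence central; the other spokes are expanded in
    the standard basis of the parameter space.\<close>
  proof (cases "v \<in> root ` verts support_graph")
    case True
    then have "root v = v"
      using walks.component_root_idem by (auto simp del: support_graph_simps)
    then show ?thesis
      using central[OF potential_root_in_gains[OF v], of "- \<alpha>"]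
      by (simp add: spoke_def link_loop left.neg)
  next
    case False
    interpret spoke: Vector_Spaces.linear "(*s)" gain_scale "spoke v"
      unfolding spoke_def by (rule linear_link)
    have "spoke v (axis i 1) \<in> ?S" for i
      using False v by (intro gain_space.span_base)
      (auto simp: spokes_def simp del: support_graph_simps)
    then have "spoke v (\<Sum>i \<in> UNIV. \<alpha> $ i *s axis i 1) \<in> ?S"
      by (simp add: spoke.sum spoke.scale gain_space.span_sum gain_space.span_scale)
    then show ?thesis
      by (simp only: basis_expansion)
  qed
  have "link b (tail G e) (head G e) (\<psi> e) \<alpha> \<in> ?S" if "e \<in> arcs G" for e \<alpha>
    unfolding link_arc_eq[OF that] using that
    by (intro gain_space.span_diff spoke central arc_gain_in_gains) auto
  then show ?thesis
    unfolding edge_span_eq by (intro gain_space.span_minimal gain_space.subspace_span) blast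
qed

text \<open>The spokes together with a basis of \<open>gain_values\<close> form a basis of
  \<open>edge_span\<close>; its cardinality is the gain rank.\<close>

lemma gain_rank_eq_dim_edge_span: "gain_rank b G \<psi> (arcs G) = int (gain_space.dim edge_span)"
proof -
  obtain B where B: "B \<subseteq> gain_values" "vec.independent B" "gain_values \<subseteq> vec.span B"
    "card B = vec.dim gain_values"
    by (rule vec.basis_exists)
  have "gain_space.dim edge_span = CARD('d) * card nonroots + card B"
  proof (rule gain_space.dim_unique)
    show "spokes \<union> Pair 0 ` B \<subseteq> edge_span"
      using spokes_subset_edge_span central_in_edge_span B(1) by blast
  qed (use B in \<open>simp_all add: edge_span_subset independent_spokes_Un_central
      card_spokes_Un_central vec.finiteI_independent del: support_graph_simps\<close>)
  then show ?thesis
    by (simp add: gain_rank_def gain_dim_def B(4) card_nonroots right_diff_distrib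
        flip: support_graph_def del: support_graph_simps)
qed

end

theorem theorem8p6:
  fixes b :: "'f::field ^ 'd \<Rightarrow> 'f ^ 't \<Rightarrow> 'f ^ 'k"
    and \<Gamma> :: "('f ^ 't) set"
    and G :: "('v, 'e) pre_digraph"
    and \<psi> :: "'e \<Rightarrow> 'f ^ 't"
  assumes "bilinear_over b"
    and "gain_graph G \<Gamma> \<psi>"
  shows "gain_rank b G \<psi> (arcs G) =
    int (gain_space.dim (gain_space.span (\<Union>e \<in> arcs G. edge_space b G \<psi> e)))"
proof -
  interpret gain_graph G \<Gamma> \<psi>
    by fact
  interpret bilinear_gain_graph G \<Gamma> \<psi> b
    by standard fact
  show ?thesis
    by (rule gain_rank_eq_dim_edge_span)
qed

end
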